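(* Let $G$ be a locally compact, compactly generated group, and $X\subset G$ a subset. Then $(G,X)$ has relative Property (T) if and only if $X$ is bounded for the $H$-metric on $G$.
   Context: For a locally compact group $G$ and a subset $X\subset G$, the pair $(G,X)$ has relative Property (T) if for every net $(\varphi_i)$ of continuous normalized (i.e. $\varphi_i(1)=1$) positive definite functions on $G$ that converges to $1$ uniformly on compact subsets of $G$, the convergence is uniform on $X$. A conditionally negative definite function on $G$ is a function $\psi:G\to\mathbf{R}$ with $\psi(1)=0$, $\psi(g)=\psi(g^{-1})$, and $\sum_{i,j}c_ic_j\psi(g_i^{-1}g_j)\le 0$ for all $g_1,\dots,g_n\in G$ and $c_1,\dots,c_n\in\mathbf{R}$ with $\sum c_i=0$. The $H$-metric: let $K$ be a relatively compact, open generating subset of $G$. Let $\Psi_K:G\to\mathbf{R}_+$ be the pointwise supremum of all continuous conditionally negative definite functions $\psi$ on $G$ such that $\psi\le 1$ on $K$. Then $\Psi_K^{1/2}$ is a (finite-valued) length function, and the $H$-metric is the left-invariant metric $d(g,h)=\Psi_K(g^{-1}h)^{1/2}$. Different choices of $K$ give bi-Lipschitz equivalent metrics, so boundedness does not depend on $K$. *)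

theory Defs
  imports "HOL-Analysis.Analysis" "HOL-Algebra.Generated_Groups"
begin

text \<open>Locally compact groups are Hausdorff by convention.\<close>

definition locally_compact_group :: "('a, 'm) monoid_scheme \<Rightarrow> 'a topology \<Rightarrow> bool" where
  "locally_compact_group G T \<longleftrightarrow>
     group G \<and> topspace T = carrier G \<and>
     continuous_map (prod_topology T T) T (\<lambda>(x, y). x \<otimes>\<^bsub>G\<^esub> y) \<and>
     continuous_map T T (\<lambda>x. inv\<^bsub>G\<^esub> x) \<and>
     locally_compact_space T \<and> Hausdorff_space T"

definition compactly_generated_group :: "('a, 'm) monoid_scheme \<Rightarrow> 'a topology \<Rightarrow> bool" where
  "compactly_generated_group G T \<longleftrightarrow> (\<exists>S. compactin T S \<and> generate G S = carrier G)"

definition positive_definite :: "('a, 'm) monoid_scheme \<Rightarrow> ('a \<Rightarrow> complex) \<Rightarrow> bool" where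
  "positive_definite G \<phi> \<longleftrightarrow>
     (\<forall>n (g :: nat \<Rightarrow> 'a) (c :: nat \<Rightarrow> complex). (\<forall>i<n. g i \<in> carrier G) \<longrightarrow>
        (\<Sum>i<n. \<Sum>j<n. c i * cnj (c j) * \<phi> (inv\<^bsub>G\<^esub> (g i) \<otimes>\<^bsub>G\<^esub> g j)) \<in> \<real>\<^sub>\<ge>\<^sub>0)"

definition cont_normalized_pos_def ::
    "('a, 'm) monoid_scheme \<Rightarrow> 'a topology \<Rightarrow> ('a \<Rightarrow> complex) set" where
  "cont_normalized_pos_def G T =
     {\<phi>. continuous_map T euclidean \<phi> \<and> positive_definite G \<phi> \<and> \<phi> \<one>\<^bsub>G\<^esub> = 1}"

text \<open>
  Uniform convergence of a net \<open>(\<phi>\<^sub>i)\<close> only depends on the filter generated by the tails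
  \<open>{\<phi>\<^sub>j | j \<ge> i}\<close>. Quantifying over the filters on the function space therefore amounts to
  quantifying over all nets, without a bound on the size of the index sets; see
  \<open>relative_property_T_netD\<close> and \<open>relative_property_T_netI\<close> below.
\<close>

definition relative_property_T ::
    "('a, 'm) monoid_scheme \<Rightarrow> 'a topology \<Rightarrow> 'a set \<Rightarrow> bool" where
  "relative_property_T G T X \<longleftrightarrow>
     (\<forall>F :: ('a \<Rightarrow> complex) filter.
        (\<forall>\<^sub>F \<phi> in F. \<phi> \<in> cont_normalized_pos_def G T) \<longrightarrow>
        (\<forall>C. compactin T C \<longrightarrow> uniform_limit C (\<lambda>\<phi>. \<phi>) (\<lambda>_. 1) F) \<longrightarrow>
        uniform_limit X (\<lambda>\<phi>. \<phi>) (\<lambda>_. 1) F)"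

definition cond_negative_definite :: "('a, 'm) monoid_scheme \<Rightarrow> ('a \<Rightarrow> real) \<Rightarrow> bool" where
  "cond_negative_definite G \<psi> \<longleftrightarrow>
     \<psi> \<one>\<^bsub>G\<^esub> = 0 \<and>
     (\<forall>g\<in>carrier G. \<psi> g = \<psi> (inv\<^bsub>G\<^esub> g)) \<and>
     (\<forall>n (g :: nat \<Rightarrow> 'a) (c :: nat \<Rightarrow> real).
        (\<forall>i<n. g i \<in> carrier G) \<longrightarrow> (\<Sum>i<n. c i) = 0 \<longrightarrow>
        (\<Sum>i<n. \<Sum>j<n. c i * c j * \<psi> (inv\<^bsub>G\<^esub> (g i) \<otimes>\<^bsub>G\<^esub> g j)) \<le> 0)"

definition H_generating_set ::
    "('a, 'm) monoid_scheme \<Rightarrow> 'a topology \<Rightarrow> 'a set \<Rightarrow> bool" where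
  "H_generating_set G T K \<longleftrightarrow>
     openin T K \<and> compactin T (Abstract_Topology.closure_of T K) \<and> generate G K = carrier G"

text \<open>
  The supremum is taken in the reals. On \<open>carrier G\<close> the set of values is nonempty (take
  \<open>\<psi> = 0\<close>), and it is bounded above when \<open>K\<close> generates \<open>G\<close>, because the square root of a
  conditionally negative definite function is subadditive.
\<close>

definition H_Psi ::
    "('a, 'm) monoid_scheme \<Rightarrow> 'a topology \<Rightarrow> 'a set \<Rightarrow> 'a \<Rightarrow> real" where
  "H_Psi G T K g =
     (SUP \<psi>\<in>{\<psi>. continuous_map T euclideanreal \<psi> \<and> cond_negative_definite G \<psi> \<and>
                  (\<forall>x\<in>K. \<psi> x \<le> 1)}. \<psi> g)"

definition H_metric ::
    "('a, 'm) monoid_scheme \<Rightarrow> 'a topology \<Rightarrow> 'a set \<Rightarrow> 'a \<Rightarrow> 'a \<Rightarrow> real" where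
  "H_metric G T K g h = sqrt (H_Psi G T K (inv\<^bsub>G\<^esub> g \<otimes>\<^bsub>G\<^esub> h))"

definition H_bounded ::
    "('a, 'm) monoid_scheme \<Rightarrow> 'a topology \<Rightarrow> 'a set \<Rightarrow> 'a set \<Rightarrow> bool" where
  "H_bounded G T K X \<longleftrightarrow> (\<exists>B. \<forall>x\<in>X. \<forall>y\<in>X. H_metric G T K x y \<le> B)"


text \<open>The filter formulation agrees with the one by nets indexed by directed preorders.\<close>

definition directed_preorder :: "'i set \<Rightarrow> ('i \<Rightarrow> 'i \<Rightarrow> bool) \<Rightarrow> bool" where
  "directed_preorder I r \<longleftrightarrow>
     I \<noteq> {} \<and> (\<forall>i\<in>I. r i i) \<and>
     (\<forall>i\<in>I. \<forall>j\<in>I. \<forall>k\<in>I. r i j \<longrightarrow> r j k \<longrightarrow> r i k) \<and>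
     (\<forall>i\<in>I. \<forall>j\<in>I. \<exists>k\<in>I. r i k \<and> r j k)"

definition net_unif_to_1 ::
    "'i set \<Rightarrow> ('i \<Rightarrow> 'i \<Rightarrow> bool) \<Rightarrow> ('i \<Rightarrow> 'a \<Rightarrow> complex) \<Rightarrow> 'a set \<Rightarrow> bool" where
  "net_unif_to_1 I r \<phi> S \<longleftrightarrow>
     (\<forall>e>0. \<exists>i\<in>I. \<forall>j\<in>I. r i j \<longrightarrow> (\<forall>x\<in>S. dist (\<phi> j x) 1 < e))"

lemma relative_property_T_netD:
  fixes I :: "'i set" and \<phi> :: "'i \<Rightarrow> 'a \<Rightarrow> complex"
  assumes T: "relative_property_T G T X" and dir: "directed_preorder I r"
    and mem: "\<forall>i\<in>I. \<phi> i \<in> cont_normalized_pos_def G T"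
    and lim: "\<forall>C. compactin T C \<longrightarrow> net_unif_to_1 I r \<phi> C"
  shows "net_unif_to_1 I r \<phi> X"
proof -
  have trans_r: "r i k" if "i \<in> I" "j \<in> I" "k \<in> I" "r i j" "r j k" for i j k
    using dir that unfolding directed_preorder_def by meson
  define F where "F = (INF i\<in>I. principal {\<phi> j | j. j \<in> I \<and> r i j})"
  have ev: "eventually P F \<longleftrightarrow> (\<exists>i\<in>I. \<forall>j\<in>I. r i j \<longrightarrow> P (\<phi> j))" for P
  proof -
    have "eventually P F \<longleftrightarrow> (\<exists>i\<in>I. eventually P (principal {\<phi> j | j. j \<in> I \<and> r i j}))"
      unfolding F_def
    proof (rule eventually_INF_base)
      show "I \<noteq> {}" using dir by (simp add: directed_preorder_def)
      fix i j assume ij: "i \<in> I" "j \<in> I"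
      then obtain k where k: "k \<in> I" "r i k" "r j k"
        using dir unfolding directed_preorder_def by meson
      have "{\<phi> l | l. l \<in> I \<and> r k l} \<subseteq> {\<phi> l | l. l \<in> I \<and> r i l} \<inter> {\<phi> l | l. l \<in> I \<and> r j l}"
        using trans_r[OF ij(1) k(1) _ k(2)] trans_r[OF ij(2) k(1) _ k(3)] by auto
      then show "\<exists>x\<in>I. principal {\<phi> j | j. j \<in> I \<and> r x j} \<le>
          inf (principal {\<phi> j | j. j \<in> I \<and> r i j}) (principal {\<phi> l | l. l \<in> I \<and> r j l})"
        using k(1) by (intro bexI[of _ k]) simp_all
    qed
    then show ?thesis by (auto simp: eventually_principal)
  qed
  have unif: "uniform_limit S (\<lambda>\<phi>. \<phi>) (\<lambda>_. 1) F \<longleftrightarrow> net_unif_to_1 I r \<phi> S" for S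
    by (simp add: uniform_limit_iff net_unif_to_1_def ev)
  have "I \<noteq> {}" using dir by (simp add: directed_preorder_def)
  then have "\<forall>\<^sub>F \<phi> in F. \<phi> \<in> cont_normalized_pos_def G T"
    unfolding ev using mem by blast
  moreover have "\<forall>C. compactin T C \<longrightarrow> uniform_limit C (\<lambda>\<phi>. \<phi>) (\<lambda>_. 1) F"
    using lim unif by blast
  ultimately have "uniform_limit X (\<lambda>\<phi>. \<phi>) (\<lambda>_. 1) F"
    using T unfolding relative_property_T_def by blast
  then show ?thesis by (simp only: unif)
qed

lemma relative_property_T_netI:
  fixes G :: "('a, 'm) monoid_scheme"
  assumes "\<And>(I :: (('a \<Rightarrow> complex) \<times> ('a \<Rightarrow> complex) set) set) r \<phi>.
      directed_preorder I r \<Longrightarrow> \<forall>i\<in>I. \<phi> i \<in> cont_normalized_pos_def G T \<Longrightarrow>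
      \<forall>C. compactin T C \<longrightarrow> net_unif_to_1 I r \<phi> C \<Longrightarrow> net_unif_to_1 I r \<phi> X"
  shows "relative_property_T G T X"
  unfolding relative_property_T_def
proof (intro allI impI)
  fix F :: "('a \<Rightarrow> complex) filter"
  let ?P = "cont_normalized_pos_def G T"
  assume P: "\<forall>\<^sub>F \<phi> in F. \<phi> \<in> ?P"
    and lim: "\<forall>C. compactin T C \<longrightarrow> uniform_limit C (\<lambda>\<phi>. \<phi>) (\<lambda>_. 1) F"
  show "uniform_limit X (\<lambda>\<phi>. \<phi>) (\<lambda>_. 1) F"
  proof (cases "F = bot")
    case True
    then show ?thesis by (simp add: uniform_limit_iff)
  next
    case False
    define I where "I = {(f :: 'a \<Rightarrow> complex, S). (\<forall>\<^sub>F \<phi> in F. \<phi> \<in> S) \<and> f \<in> S \<and> f \<in> ?P}"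
    define r where "r = (\<lambda>(p :: ('a \<Rightarrow> complex) \<times> ('a \<Rightarrow> complex) set)
        (q :: ('a \<Rightarrow> complex) \<times> ('a \<Rightarrow> complex) set). snd q \<subseteq> snd p)"
    have pick: "\<exists>f. (f, S) \<in> I" if "\<forall>\<^sub>F \<phi> in F. \<phi> \<in> S" for S
    proof -
      have "\<forall>\<^sub>F \<phi> in F. \<phi> \<in> S \<and> \<phi> \<in> ?P" using that P by (rule eventually_conj)
      then obtain f where "f \<in> S" "f \<in> ?P" using False eventually_happens' by blast
      then show ?thesis using that by (auto simp: I_def)
    qed
    have dir: "directed_preorder I r"
      unfolding directed_preorder_def
    proof (intro conjI ballI)
      show "I \<noteq> {}" using pick[of UNIV] by auto
      fix p q assume pq: "p \<in> I" "q \<in> I"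
      have "\<forall>\<^sub>F \<phi> in F. \<phi> \<in> snd p \<inter> snd q"
        using pq by (auto simp: I_def eventually_conj_iff)
      then obtain f where "(f, snd p \<inter> snd q) \<in> I" using pick by blast
      then show "\<exists>k\<in>I. r p k \<and> r q k" by (rule bexI[rotated]) (auto simp: r_def)
    qed (auto simp: r_def)
    have unif: "net_unif_to_1 I r fst S \<longleftrightarrow> uniform_limit S (\<lambda>\<phi>. \<phi>) (\<lambda>_. 1) F" for S
      unfolding net_unif_to_1_def uniform_limit_iff
    proof (intro all_cong1 imp_cong refl)
      fix e :: real
      let ?Q = "\<lambda>\<phi>. \<forall>x\<in>S. dist (\<phi> x) 1 < e"
      show "(\<exists>i\<in>I. \<forall>j\<in>I. r i j \<longrightarrow> ?Q (fst j)) \<longleftrightarrow> (\<forall>\<^sub>F \<phi> in F. ?Q \<phi>)"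
      proof
        assume "\<exists>i\<in>I. \<forall>j\<in>I. r i j \<longrightarrow> ?Q (fst j)"
        then obtain f A where fA: "(f, A) \<in> I" and *: "\<forall>j\<in>I. r (f, A) j \<longrightarrow> ?Q (fst j)"
          by auto
        from fA have "\<forall>\<^sub>F \<phi> in F. \<phi> \<in> A" by (simp add: I_def)
        with P show "\<forall>\<^sub>F \<phi> in F. ?Q \<phi>"
        proof eventually_elim
          case (elim \<phi>)
          then have "(\<phi>, A) \<in> I" using fA by (simp add: I_def)
          then show ?case using * by (force simp: r_def)
        qed
      next
        assume "\<forall>\<^sub>F \<phi> in F. ?Q \<phi>"
        then obtain f where f: "(f, {\<phi>. ?Q \<phi>}) \<in> I" using pick[of "{\<phi>. ?Q \<phi>}"] by auto
        show "\<exists>i\<in>I. \<forall>j\<in>I. r i j \<longrightarrow> ?Q (fst j)"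
          by (rule bexI[OF _ f]) (auto simp: I_def r_def)
      qed
    qed
    have "net_unif_to_1 I r fst X"
    proof (rule assms[OF dir])
      show "\<forall>i\<in>I. fst i \<in> ?P" by (auto simp: I_def)
      show "\<forall>C. compactin T C \<longrightarrow> net_unif_to_1 I r fst C" using lim by (simp only: unif)
    qed
    then show ?thesis by (simp add: unif)
  qed
qed

lemma H_generating_set_exists:
  assumes "locally_compact_group G T" "compactly_generated_group G T"
  shows "\<exists>K. H_generating_set G T K"
proof -
  from assms(1) have G: "group G" "topspace T = carrier G" "Hausdorff_space T"
    "locally_compact_space T"
    by (auto simp: locally_compact_group_def)
  obtain S where S: "compactin T S" "generate G S = carrier G"
    using assms(2) by (auto simp: compactly_generated_group_def)
  obtain U L where UL: "openin T U" "compactin T L" "closedin T L" "S \<subseteq> U" "U \<subseteq> L"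
    using iffD1[OF locally_compact_space_compact_closed_compact[OF disjI1[OF G(3)]] G(4)] S(1)
    by blast
  have "Abstract_Topology.closure_of T U \<subseteq> L" using UL by (simp add: closure_of_minimal)
  then have "compactin T (Abstract_Topology.closure_of T U)"
    by (rule closed_compactin[OF UL(2) _ closedin_closure_of])
  moreover have "U \<subseteq> carrier G" using openin_subset[OF UL(1)] G(2) by simp
  then have "generate G U = carrier G"
    using group.mono_generate[OF G(1) UL(4)] group.generate_incl[OF G(1), of U] S(2)
    by (simp add: subset_antisym)
  ultimately show ?thesis using UL(1) unfolding H_generating_set_def by blast
qed

end

theory Submission
  imports Defs
begin

text \<open>
  If \<open>\<phi>\<close> is normalized positive definite, then \<open>1 - Re \<phi>\<close> is conditionally negative definite, so
  a bound \<open>B\<close> of \<open>\<Psi>\<^sub>K\<close> on \<open>X\<close> and \<open>1 - Re \<phi> \<le> \<delta>\<close> on \<open>K\<close> give \<open>1 - Re \<phi> \<le> B \<delta>\<close> on \<open>X\<close>;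
  moreover \<open>\<bar>1 - \<phi>\<bar>\<^sup>2 \<le> 2 (1 - Re \<phi>)\<close>. Conversely, if \<open>\<Psi>\<^sub>K\<close> is unbounded on \<open>X\<close>, choose
  \<open>\<psi>\<^sub>n \<le> 1\<close> on \<open>K\<close> with \<open>\<psi>\<^sub>n > n + 1\<close> somewhere on \<open>X\<close>. The functions \<open>\<psi>\<^sub>n\<close> are uniformly bounded on
  every compact set, so the functions \<open>exp (- \<psi>\<^sub>n / (n + 1))\<close>, positive definite by Schoenberg's
  theorem, converge to 1 uniformly on compact sets but not on \<open>X\<close>.
\<close>

subsection \<open>Positive semidefinite kernels and the Schur product\<close>

text \<open>Symmetry is demanded separately because a real quadratic form sees only the symmetric
  part of its kernel.\<close>

definition psd_on :: "'i set \<Rightarrow> ('i \<Rightarrow> 'i \<Rightarrow> real) \<Rightarrow> bool" where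
  "psd_on S A \<longleftrightarrow> (\<forall>i\<in>S. \<forall>j\<in>S. A i j = A j i) \<and>
     (\<forall>c. 0 \<le> (\<Sum>i\<in>S. \<Sum>j\<in>S. c i * c j * A i j))"

lemma psd_on_sym: "psd_on S A \<Longrightarrow> i \<in> S \<Longrightarrow> j \<in> S \<Longrightarrow> A i j = A j i"
  by (simp add: psd_on_def)

lemma psd_on_nonneg: "psd_on S A \<Longrightarrow> 0 \<le> (\<Sum>i\<in>S. \<Sum>j\<in>S. c i * c j * A i j)"
  by (simp add: psd_on_def)

text \<open>This is the passage to \<open>D A D\<close> with \<open>D\<close> diagonal: the new form
  at \<open>c\<close> is the old one at the entrywise product of \<open>c\<close> and
  \<open>d\<close>.\<close>

lemma psd_on_congruence:
  assumes "psd_on S A"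
  shows "psd_on S (\<lambda>i j. d i * d j * A i j)"
  unfolding psd_on_def
proof (intro conjI ballI allI)
  show "d i * d j * A i j = d j * d i * A j i" if "i \<in> S" "j \<in> S" for i j
    using psd_on_sym[OF assms that] by simp
  show "0 \<le> (\<Sum>i\<in>S. \<Sum>j\<in>S. c i * c j * (d i * d j * A i j))" for c
    using psd_on_nonneg[OF assms, of "\<lambda>i. c i * d i"] by (simp add: mult_ac)
qed

lemma psd_on_const_1: "psd_on S (\<lambda>i j. 1)"
proof -
  have "(\<Sum>i\<in>S. \<Sum>j\<in>S. c i * c j * 1) = (\<Sum>i\<in>S. c i)\<^sup>2" for c :: "'a \<Rightarrow> real"
    by (simp add: power2_eq_square sum_product)
  then show ?thesis by (simp add: psd_on_def)
qed

text \<open>Serves both to eliminate an index in the Schur product theorem and, later, to adjoin the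
  point \<one> to a finite family in the group.\<close>

lemma sum_square_insert:
  fixes f :: "'i \<Rightarrow> 'i \<Rightarrow> real"
  assumes "finite S" "x \<notin> S" "\<And>i. i \<in> S \<Longrightarrow> f i x = f x i"
  shows "(\<Sum>i\<in>insert x S. \<Sum>j\<in>insert x S. f i j) =
    f x x + 2 * (\<Sum>i\<in>S. f x i) + (\<Sum>i\<in>S. \<Sum>j\<in>S. f i j)"
  using assms by (simp add: sum.distrib)

text \<open>Evaluate the form at \<open>c\<close> extended by the value \<open>t\<close> at
  \<open>x\<close>. As a quadratic polynomial in \<open>t\<close> it yields the Schur complement for
  the best \<open>t\<close>, and the restriction to \<open>S\<close> for
  \<open>t = 0\<close>.\<close>

lemma psd_on_insert_quadratic:
  assumes "finite S" "x \<notin> S" "psd_on (insert x S) A"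
  shows "0 \<le> (\<Sum>i\<in>S. \<Sum>j\<in>S. c i * c j * A i j) + 2 * t * (\<Sum>i\<in>S. c i * A x i) + t\<^sup>2 * A x x"
proof -
  define d where "d = c(x := t)"
  have d: "d x = t" "\<And>i. i \<in> S \<Longrightarrow> d i = c i"
    using assms(2) by (auto simp: d_def)
  have "0 \<le> (\<Sum>i\<in>insert x S. \<Sum>j\<in>insert x S. d i * d j * A i j)"
    by (rule psd_on_nonneg[OF assms(3)])
  also have "\<dots> = d x * d x * A x x + 2 * (\<Sum>i\<in>S. d x * d i * A x i)
      + (\<Sum>i\<in>S. \<Sum>j\<in>S. d i * d j * A i j)"
    using psd_on_sym[OF assms(3)] by (intro sum_square_insert assms(1,2)) simp
  also have "\<dots> = (\<Sum>i\<in>S. \<Sum>j\<in>S. c i * c j * A i j) + 2 * t * (\<Sum>i\<in>S. c i * A x i) + t\<^sup>2 * A x x"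
    by (simp add: d sum_distrib_left power2_eq_square mult_ac cong: sum.cong)
  finally show ?thesis .
qed

lemma quadratic_nonneg_degenerate:
  fixes q L :: real
  assumes "\<And>t. 0 \<le> q + 2 * t * L"
  shows "L = 0"
proof (rule ccontr)
  assume "L \<noteq> 0"
  \<comment> \<open>At this \<open>t\<close> the affine function takes the value -1.\<close>
  then show False using assms[of "- (q + 1) / (2 * L)"] by (simp add: field_simps)
qed

text \<open>
  Induction on the index set by eliminating \<open>x\<close>: if \<open>A x x = 0\<close> then the row of \<open>x\<close> vanishes, and
  the Schur complement below is \<open>A\<close> itself since \<open>u / 0 = 0\<close>.
\<close>

lemma psd_on_sum_mult_nonneg:
  assumes "finite S" "psd_on S A" "psd_on S B"
  shows "0 \<le> (\<Sum>i\<in>S. \<Sum>j\<in>S. A i j * B i j)"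
  using assms
proof (induction S arbitrary: A rule: finite_induct)
  case empty
  then show ?case by simp
next
  case (insert x S)
  note quad = psd_on_insert_quadratic[OF insert.hyps insert.prems(1)]
  note symA = psd_on_sym[OF insert.prems(1)] and symB = psd_on_sym[OF insert.prems(2)]
  define a where "a = A x x"
  define A' where "A' = (\<lambda>i j. A i j - A x i * A x j / a)"
  have "a \<ge> 0" using quad[of "\<lambda>_. 0" 1] by (simp add: a_def)
  have row0: "A x j = 0" if "a = 0" "j \<in> S" for j
  proof -
    \<comment> \<open>The test vector is the unit vector at \<open>j\<close>. Since
      \<open>a = 0\<close>, the form is affine in \<open>t\<close>, so its linear coefficient must
      vanish.\<close>
    have "(\<Sum>i\<in>S. of_bool (i = j) * A x i) = A x j"
      using insert.hyps(1) that(2) by (simp add: sum.delta of_bool_def if_distrib[of "\<lambda>u. u * _"] cong: if_cong)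
    moreover have "(\<Sum>i\<in>S. of_bool (i = j) * A x i) = 0"
      using quad[of "\<lambda>i. of_bool (i = j)"] that(1) by (intro quadratic_nonneg_degenerate) (simp add: a_def)
    ultimately show ?thesis by simp
  qed
  have A'x: "A' x j = 0" if "j \<in> insert x S" for j
    using row0[of j] that by (cases "a = 0") (auto simp: A'_def a_def)
  have "psd_on S A'"
    unfolding psd_on_def
  proof (intro conjI ballI allI)
    show "A' i j = A' j i" if "i \<in> S" "j \<in> S" for i j
      using symA[of i j] that by (simp add: A'_def)
    fix c
    define L where "L = (\<Sum>i\<in>S. c i * A x i)"
    have "(\<Sum>i\<in>S. \<Sum>j\<in>S. c i * c j * A' i j) =
        (\<Sum>i\<in>S. \<Sum>j\<in>S. c i * c j * A i j) - (\<Sum>i\<in>S. \<Sum>j\<in>S. (c i * A x i) * (c j * A x j)) / a"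
      by (simp add: A'_def algebra_simps sum_subtractf sum_divide_distrib)
    also have "\<dots> = (\<Sum>i\<in>S. \<Sum>j\<in>S. c i * c j * A i j) - L\<^sup>2 / a"
      by (simp add: L_def power2_eq_square sum_product)
    \<comment> \<open>For \<open>a > 0\<close> this is the minimum of the quadratic, attained at
      \<open>t = - L / a\<close>; for \<open>a = 0\<close> the quotient is 0 and
      \<open>t = 0\<close> suffices.\<close>
    also have "\<dots> \<ge> 0"
      using quad[of c "- L / a"] quad[of c 0]
      by (cases "a = 0") (simp_all add: L_def[symmetric] a_def[symmetric] power2_eq_square)
    finally show "0 \<le> (\<Sum>i\<in>S. \<Sum>j\<in>S. c i * c j * A' i j)" .
  qed
  moreover have "psd_on S B"
    unfolding psd_on_def
    using symB psd_on_insert_quadratic[OF insert.hyps insert.prems(2), of _ 0] by simp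
  ultimately have "0 \<le> (\<Sum>i\<in>S. \<Sum>j\<in>S. A' i j * B i j)" by (rule insert.IH)
  \<comment> \<open>The row and the column of \<open>x\<close> in \<open>A'\<close> vanish, so
    putting \<open>x\<close> back changes nothing.\<close>
  also have "\<dots> = (\<Sum>i\<in>insert x S. \<Sum>j\<in>insert x S. A' i j * B i j)"
  proof -
    have "A' i x = 0" if "i \<in> S" for i
      using A'x[of i] that symA[of i x] by (simp add: A'_def mult.commute)
    then show ?thesis
      using insert.hyps A'x by (simp add: sum_square_insert)
  qed
  finally have 1: "0 \<le> (\<Sum>i\<in>insert x S. \<Sum>j\<in>insert x S. A' i j * B i j)" .
  \<comment> \<open>The rank-one part \<open>A - A'\<close> contributes the form of \<open>B\<close>
    at the vector \<open>A x\<close>, divided by \<open>a\<close>.\<close>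
  have 2: "0 \<le> (\<Sum>i\<in>insert x S. \<Sum>j\<in>insert x S. A x i * A x j * B i j) / a"
    using psd_on_nonneg[OF insert.prems(2)] \<open>a \<ge> 0\<close> by (rule divide_nonneg_nonneg)
  have "(\<Sum>i\<in>insert x S. \<Sum>j\<in>insert x S. A i j * B i j) =
      (\<Sum>i\<in>insert x S. \<Sum>j\<in>insert x S. A' i j * B i j + A x i * A x j * B i j / a)"
    by (simp only: A'_def) (simp add: algebra_simps)
  also have "\<dots> = (\<Sum>i\<in>insert x S. \<Sum>j\<in>insert x S. A' i j * B i j)
      + (\<Sum>i\<in>insert x S. \<Sum>j\<in>insert x S. A x i * A x j * B i j) / a"
    by (simp only: sum.distrib sum_divide_distrib)
  finally show ?case using 1 2 by linarith
qed

text \<open>Schur product theorem: a diagonal congruence absorbs the coefficients \<open>c\<close>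
  into \<open>A\<close>, leaving the sum of entrywise products.\<close>

lemma psd_on_mult:
  assumes "finite S" "psd_on S A" "psd_on S B"
  shows "psd_on S (\<lambda>i j. A i j * B i j)"
  unfolding psd_on_def
proof (intro conjI ballI allI)
  show "A i j * B i j = A j i * B j i" if "i \<in> S" "j \<in> S" for i j
    using psd_on_sym[OF assms(2) that] psd_on_sym[OF assms(3) that] by simp
  show "0 \<le> (\<Sum>i\<in>S. \<Sum>j\<in>S. c i * c j * (A i j * B i j))" for c
    using psd_on_sum_mult_nonneg[OF assms(1) psd_on_congruence[OF assms(2), of c] assms(3)]
    by (simp add: mult_ac)
qed

lemma psd_on_power:
  assumes "finite S" "psd_on S A"
  shows "psd_on S (\<lambda>i j. A i j ^ n)"
  by (induction n) (simp_all add: psd_on_const_1 psd_on_mult assms)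

text \<open>Expand the exponential entrywise: the entrywise powers are positive semidefinite, the
  series has positive coefficients, and nonnegativity passes to the limit.\<close>

lemma psd_on_exp:
  assumes "finite S" "psd_on S A"
  shows "psd_on S (\<lambda>i j. exp (A i j))"
  unfolding psd_on_def
proof (intro conjI ballI allI)
  show "exp (A i j) = exp (A j i)" if "i \<in> S" "j \<in> S" for i j
    using psd_on_sym[OF assms(2) that] by simp
  fix c
  have sums: "(\<lambda>n. \<Sum>i\<in>S. \<Sum>j\<in>S. c i * c j * (A i j ^ n /\<^sub>R fact n)) sums
      (\<Sum>i\<in>S. \<Sum>j\<in>S. c i * c j * exp (A i j))"
    by (intro sums_sum sums_mult exp_converges)
  have nonneg: "0 \<le> (\<Sum>i\<in>S. \<Sum>j\<in>S. c i * c j * (A i j ^ n /\<^sub>R fact n))" for n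
  proof -
    have "(\<Sum>i\<in>S. \<Sum>j\<in>S. c i * c j * (A i j ^ n /\<^sub>R fact n)) =
        (\<Sum>i\<in>S. \<Sum>j\<in>S. c i * c j * A i j ^ n) / fact n"
      by (simp add: sum_distrib_left divide_inverse mult_ac)
    also have "\<dots> \<ge> 0"
      by (intro divide_nonneg_nonneg psd_on_nonneg psd_on_power assms) simp
    finally show ?thesis .
  qed
  show "0 \<le> (\<Sum>i\<in>S. \<Sum>j\<in>S. c i * c j * exp (A i j))"
    by (rule sums_le[OF nonneg sums_zero sums])
qed

text \<open>By symmetry of the real kernel the mixed terms cancel, so the Hermitian form is the sum
  of the real forms at the real and imaginary parts of \<open>c\<close>.\<close>

lemma psd_on_complex:
  assumes "psd_on S A"
  shows "(\<Sum>i\<in>S. \<Sum>j\<in>S. c i * cnj (c j) * complex_of_real (A i j)) \<in> \<real>\<^sub>\<ge>\<^sub>0"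
proof -
  let ?s = "\<lambda>f g. \<Sum>i\<in>S. \<Sum>j\<in>S. f (c i) * g (c j) * A i j"
  have "?s Im Re = (\<Sum>i\<in>S. \<Sum>j\<in>S. Im (c j) * Re (c i) * A j i)"
    by (rule sum.swap)
  also have "\<dots> = ?s Re Im"
    using psd_on_sym[OF assms] by (intro sum.cong refl) simp
  finally have "?s Im Re = ?s Re Im" .
  moreover have "Re (\<Sum>i\<in>S. \<Sum>j\<in>S. c i * cnj (c j) * complex_of_real (A i j)) = ?s Re Re + ?s Im Im"
    by (simp add: algebra_simps sum.distrib)
  moreover have "Im (\<Sum>i\<in>S. \<Sum>j\<in>S. c i * cnj (c j) * complex_of_real (A i j)) = ?s Im Re - ?s Re Im"
    by (simp add: algebra_simps sum_subtractf)
  moreover have "0 \<le> ?s Re Re" "0 \<le> ?s Im Im"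
    by (rule psd_on_nonneg[OF assms])+
  ultimately show ?thesis
    by (simp add: complex_nonneg_Reals_iff)
qed

subsection \<open>Conditionally negative definite functions\<close>

lemma cond_negative_definite_one: "cond_negative_definite G \<psi> \<Longrightarrow> \<psi> \<one>\<^bsub>G\<^esub> = 0"
  unfolding cond_negative_definite_def by blast

lemma cond_negative_definite_inv:
  "cond_negative_definite G \<psi> \<Longrightarrow> g \<in> carrier G \<Longrightarrow> \<psi> (inv\<^bsub>G\<^esub> g) = \<psi> g"
  unfolding cond_negative_definite_def by metis

lemma cond_negative_definiteD:
  fixes n :: nat
  assumes "cond_negative_definite G \<psi>" "\<And>i. i < n \<Longrightarrow> g i \<in> carrier G" "(\<Sum>i<n. c i) = 0"
  shows "(\<Sum>i<n. \<Sum>j<n. c i * c j * \<psi> (inv\<^bsub>G\<^esub> (g i) \<otimes>\<^bsub>G\<^esub> g j)) \<le> 0"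
  by (rule assms(1)[unfolded cond_negative_definite_def, THEN conjunct2, THEN conjunct2,
      rule_format, OF assms(2,3)])

lemma cond_negative_definite_scale:
  assumes "cond_negative_definite G \<psi>" "0 \<le> t"
  shows "cond_negative_definite G (\<lambda>g. t * \<psi> g)"
  unfolding cond_negative_definite_def
proof (intro conjI ballI allI impI)
  show "t * \<psi> \<one>\<^bsub>G\<^esub> = 0"
    using cond_negative_definite_one[OF assms(1)] by simp
  show "t * \<psi> g = t * \<psi> (inv\<^bsub>G\<^esub> g)" if "g \<in> carrier G" for g
    using cond_negative_definite_inv[OF assms(1) that] by simp
  fix n and g :: "nat \<Rightarrow> 'a" and c :: "nat \<Rightarrow> real"
  assume "\<forall>i<n. g i \<in> carrier G" "(\<Sum>i<n. c i) = 0"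
  then have "t * (\<Sum>i<n. \<Sum>j<n. c i * c j * \<psi> (inv\<^bsub>G\<^esub> (g i) \<otimes>\<^bsub>G\<^esub> g j)) \<le> 0"
    using cond_negative_definiteD[OF assms(1), of n g c] assms(2) by (simp add: mult_nonneg_nonpos)
  then show "(\<Sum>i<n. \<Sum>j<n. c i * c j * (t * \<psi> (inv\<^bsub>G\<^esub> (g i) \<otimes>\<^bsub>G\<^esub> g j))) \<le> 0"
    by (simp add: sum_distrib_left mult_ac)
qed

context group
begin

lemma cond_negative_definite_inv_mult_commute:
  assumes "cond_negative_definite G \<psi>" "g \<in> carrier G" "h \<in> carrier G"
  shows "\<psi> (inv h \<otimes> g) = \<psi> (inv g \<otimes> h)"
proof -
  have "inv (inv g \<otimes> h) = inv h \<otimes> g"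
    using assms by (simp add: inv_mult_group)
  then show ?thesis
    using cond_negative_definite_inv[OF assms(1), of "inv g \<otimes> h"] assms(2,3) by simp
qed

text \<open>The points \<one> and \<open>g\<close> with coefficients 1 and -1 give
  \<open>- 2 * \<psi> g \<le> 0\<close>.\<close>

lemma cond_negative_definite_nonneg:
  assumes "cond_negative_definite G \<psi>" "g \<in> carrier G"
  shows "0 \<le> \<psi> g"
proof -
  have "\<psi> \<one> = 0" "\<psi> (inv g) = \<psi> g"
    using assms by (simp_all add: cond_negative_definite_one cond_negative_definite_inv)
  moreover have "(\<Sum>i<Suc (Suc 0). \<Sum>j<Suc (Suc 0). (if i = 0 then 1 else -1) * (if j = 0 then 1 else -1) *
      \<psi> (inv (if i = 0 then \<one> else g) \<otimes> (if j = 0 then \<one> else g))) \<le> 0"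
    by (rule cond_negative_definiteD[OF assms(1)]) (use assms(2) in auto)
  ultimately show ?thesis
    using assms(2) by simp
qed

text \<open>
  The parallelogram-type bound is weaker than the subadditivity of \<open>\<psi>\<^sup>1\<^sup>/\<^sup>2\<close>, but only boundedness is
  at stake. It comes from the points \<open>g\<inverse>, 1, h\<close> with coefficients \<open>1, -2, 1\<close>.
\<close>

lemma cond_negative_definite_mult_le:
  assumes "cond_negative_definite G \<psi>" "g \<in> carrier G" "h \<in> carrier G"
  shows "\<psi> (g \<otimes> h) \<le> 2 * (\<psi> g + \<psi> h)"
proof -
  have *: "\<psi> \<one> = 0" "\<psi> (inv g) = \<psi> g" "\<psi> (inv h) = \<psi> h"
    using assms by (simp_all add: cond_negative_definite_one cond_negative_definite_inv)
  have **: "\<psi> (inv h \<otimes> inv g) = \<psi> (g \<otimes> h)"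
    using cond_negative_definite_inv_mult_commute[OF assms(1), of "inv g" h] assms by simp
  let ?g = "\<lambda>i::nat. if i = 0 then inv g else if i = 1 then \<one> else h"
  let ?c = "\<lambda>i::nat. if i = 1 then -2 else 1"
  \<comment> \<open>The double sum equals
    \<open>2 * \<psi> (g \<otimes> h) - 4 * \<psi> g - 4 * \<psi> h\<close>.\<close>
  have "(\<Sum>i<Suc (Suc (Suc 0)). \<Sum>j<Suc (Suc (Suc 0)). ?c i * ?c j * \<psi> (inv (?g i) \<otimes> ?g j)) \<le> 0"
    by (rule cond_negative_definiteD[OF assms(1)]) (use assms(2,3) in auto)
  then show ?thesis
    using assms(2,3) * ** by simp
qed

text \<open>The kernel is twice the Gromov product based at \<one>. Arbitrary coefficients become
  admissible once the point \<one> is adjoined with the coefficient that makes the total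
  zero.\<close>

lemma cond_negative_definite_imp_psd_on:
  fixes n :: nat
  assumes \<psi>: "cond_negative_definite G \<psi>" and g: "\<And>i. i < n \<Longrightarrow> g i \<in> carrier G"
  shows "psd_on {..<n} (\<lambda>i j. \<psi> (g i) + \<psi> (g j) - \<psi> (inv (g i) \<otimes> g j))"
  unfolding psd_on_def
proof (intro conjI ballI allI)
  show "\<psi> (g i) + \<psi> (g j) - \<psi> (inv (g i) \<otimes> g j) = \<psi> (g j) + \<psi> (g i) - \<psi> (inv (g j) \<otimes> g i)"
    if "i \<in> {..<n}" "j \<in> {..<n}" for i j
    using cond_negative_definite_inv_mult_commute[OF \<psi>, of "g i" "g j"] g that by simp
  fix c :: "nat \<Rightarrow> real"
  define s where "s = (\<Sum>i<n. c i)"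
  define p where "p = (\<Sum>i<n. c i * \<psi> (g i))"
  let ?q = "\<Sum>i<n. \<Sum>j<n. c i * c j * \<psi> (inv (g i) \<otimes> g j)"
  \<comment> \<open>The old indices are below \<open>n\<close>, so index \<open>n\<close> is free
    for the adjoined point \<one>.\<close>
  define g' where "g' = g(n := \<one>)"
  define c' where "c' = c(n := - s)"
  have g': "g' n = \<one>" "\<And>i. i < n \<Longrightarrow> g' i = g i" and c': "c' n = - s" "\<And>i. i < n \<Longrightarrow> c' i = c i"
    by (auto simp: g'_def c'_def)
  have \<psi>1: "\<psi> \<one> = 0" by (rule cond_negative_definite_one[OF \<psi>])
  let ?F = "\<lambda>i j. c' i * c' j * \<psi> (inv (g' i) \<otimes> g' j)"
  have g'G: "g' i \<in> carrier G" if "i < Suc n" for i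
    using g that by (auto simp: g'_def less_Suc_eq)
  have "(\<Sum>i<Suc n. \<Sum>j<Suc n. ?F i j) \<le> 0"
    using g'G by (intro cond_negative_definiteD[OF \<psi>]) (auto simp: c'_def s_def)
  moreover have "(\<Sum>i<Suc n. \<Sum>j<Suc n. ?F i j) = ?F n n + 2 * (\<Sum>i<n. ?F n i) + (\<Sum>i<n. \<Sum>j<n. ?F i j)"
    unfolding lessThan_Suc using g'G cond_negative_definite_inv_mult_commute[OF \<psi>]
    by (intro sum_square_insert) auto
  moreover have "?F n n = 0" by (simp add: g' \<psi>1)
  moreover have "(\<Sum>i<n. ?F n i) = (\<Sum>i<n. - s * (c i * \<psi> (g i)))"
    using g by (intro sum.cong refl) (simp add: g' c')
  moreover have "\<dots> = - s * p" by (simp only: p_def sum_distrib_left)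
  moreover have "(\<Sum>i<n. \<Sum>j<n. ?F i j) = ?q"
    by (intro sum.cong refl) (simp add: g' c')
  \<comment> \<open>The form in question is exactly minus the extended sum, whose value is
    \<open>?q - 2 * s * p\<close>.\<close>
  moreover have "(\<Sum>i<n. \<Sum>j<n. c i * c j * (\<psi> (g i) + \<psi> (g j) - \<psi> (inv (g i) \<otimes> g j))) =
      (\<Sum>i<n. \<Sum>j<n. (c i * \<psi> (g i)) * c j) + (\<Sum>i<n. \<Sum>j<n. c i * (c j * \<psi> (g j))) - ?q"
    by (simp add: algebra_simps sum.distrib sum_subtractf)
  moreover have "\<dots> = 2 * s * p - ?q"
    by (simp add: sum_product[symmetric] s_def[symmetric] p_def[symmetric])
  ultimately show "0 \<le> (\<Sum>i<n. \<Sum>j<n. c i * c j * (\<psi> (g i) + \<psi> (g j) - \<psi> (inv (g i) \<otimes> g j)))"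
    by linarith
qed

text \<open>Factor \<open>exp (- \<psi> (inv (g i) \<otimes> g j))\<close> as a diagonal congruence
  by \<open>exp (- \<psi> (g i))\<close> of the exponential of the positive semidefinite kernel
  above.\<close>

theorem schoenberg:
  assumes "cond_negative_definite G \<psi>"
  shows "positive_definite G (\<lambda>g. complex_of_real (exp (- \<psi> g)))"
  unfolding positive_definite_def
proof (intro allI impI)
  fix n and g :: "nat \<Rightarrow> 'a" and c :: "nat \<Rightarrow> complex"
  assume "\<forall>i<n. g i \<in> carrier G"
  then have "psd_on {..<n} (\<lambda>i j. exp (- \<psi> (g i)) * exp (- \<psi> (g j)) *
      exp (\<psi> (g i) + \<psi> (g j) - \<psi> (inv (g i) \<otimes> g j)))"
    using assms by (intro psd_on_congruence psd_on_exp cond_negative_definite_imp_psd_on) auto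
  then have "psd_on {..<n} (\<lambda>i j. exp (- \<psi> (inv (g i) \<otimes> g j)))"
    by (simp add: exp_add[symmetric])
  then show "(\<Sum>i<n. \<Sum>j<n. c i * cnj (c j) * complex_of_real (exp (- \<psi> (inv (g i) \<otimes> g j)))) \<in> \<real>\<^sub>\<ge>\<^sub>0"
    by (rule psd_on_complex)
qed

subsection \<open>Positive definite functions\<close>

text \<open>Positivity at the points \<one> and \<open>g\<close> with coefficients 1 and
  \<open>c\<close>. The facts on symmetry and modulus below follow by choosing
  \<open>c\<close>.\<close>

lemma positive_definite_two_points:
  assumes "positive_definite G \<phi>" "\<phi> \<one> = 1" "g \<in> carrier G"
  shows "1 + c * cnj c + cnj c * \<phi> g + c * \<phi> (inv g) \<in> \<real>\<^sub>\<ge>\<^sub>0"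
proof -
  have "(\<Sum>i<Suc (Suc 0). \<Sum>j<Suc (Suc 0). (if i = 0 then 1 else c) * cnj (if j = 0 then 1 else c) *
      \<phi> (inv (if i = 0 then \<one> else g) \<otimes> (if j = 0 then \<one> else g))) \<in> \<real>\<^sub>\<ge>\<^sub>0"
    by (rule assms(1)[unfolded positive_definite_def, rule_format]) (use assms(3) in auto)
  then show ?thesis using assms by (simp add: add_ac)
qed

text \<open>Only the vanishing of the imaginary part is used: \<open>c = 1\<close> compares
  imaginary parts, \<open>c = \<i>\<close> real parts.\<close>

lemma positive_definite_inv:
  assumes "positive_definite G \<phi>" "\<phi> \<one> = 1" "g \<in> carrier G"
  shows "\<phi> (inv g) = cnj (\<phi> g)"
proof (rule complex_eqI)
  show "Im (\<phi> (inv g)) = Im (cnj (\<phi> g))"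
    using positive_definite_two_points[OF assms, of 1] by (simp add: complex_nonneg_Reals_iff)
  show "Re (\<phi> (inv g)) = Re (cnj (\<phi> g))"
    using positive_definite_two_points[OF assms, of \<i>] by (simp add: complex_nonneg_Reals_iff)
qed

text \<open>With \<open>c = - \<phi> g\<close> the two-point expression becomes 1 minus the squared
  modulus of \<open>\<phi> g\<close>.\<close>

lemma positive_definite_norm_le_1:
  assumes "positive_definite G \<phi>" "\<phi> \<one> = 1" "g \<in> carrier G"
  shows "cmod (\<phi> g) \<le> 1"
proof -
  have "(Re (\<phi> g))\<^sup>2 + (Im (\<phi> g))\<^sup>2 \<le> 1"
    using positive_definite_two_points[OF assms, of "- \<phi> g"] positive_definite_inv[OF assms]
    by (simp add: complex_nonneg_Reals_iff power2_eq_square)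
  then have "(cmod (\<phi> g))\<^sup>2 \<le> 1" by (simp only: cmod_power2)
  then show ?thesis by (simp add: abs_square_le_1)
qed

lemma positive_definite_dist_1_le:
  assumes "positive_definite G \<phi>" "\<phi> \<one> = 1" "g \<in> carrier G"
  shows "(dist (\<phi> g) 1)\<^sup>2 \<le> 2 * (1 - Re (\<phi> g))"
proof -
  have "(cmod (\<phi> g))\<^sup>2 \<le> 1"
    using positive_definite_norm_le_1[OF assms] by (simp add: abs_square_le_1)
  then show ?thesis
    by (simp add: dist_norm cmod_power2) (simp add: power2_eq_square algebra_simps)
qed

text \<open>For coefficients of sum zero the constant 1 contributes nothing, which leaves minus the
  form of the real part.\<close>

lemma positive_definite_imp_cond_negative_definite:
  assumes "positive_definite G \<phi>" "\<phi> \<one> = 1"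
  shows "cond_negative_definite G (\<lambda>g. 1 - Re (\<phi> g))"
  unfolding cond_negative_definite_def
proof (intro conjI ballI allI impI)
  show "1 - Re (\<phi> \<one>) = 0" using assms(2) by simp
  show "1 - Re (\<phi> g) = 1 - Re (\<phi> (inv g))" if "g \<in> carrier G" for g
    using positive_definite_inv[OF assms that] by simp
  fix n and g :: "nat \<Rightarrow> 'a" and c :: "nat \<Rightarrow> real"
  assume g: "\<forall>i<n. g i \<in> carrier G" and c: "(\<Sum>i<n. c i) = 0"
  have "(\<Sum>i<n. \<Sum>j<n. complex_of_real (c i) * cnj (complex_of_real (c j)) * \<phi> (inv (g i) \<otimes> g j)) \<in> \<real>\<^sub>\<ge>\<^sub>0"
    using assms(1)[unfolded positive_definite_def, rule_format, of n g "\<lambda>i. complex_of_real (c i)"] g by blast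
  then have "0 \<le> (\<Sum>i<n. \<Sum>j<n. c i * c j * Re (\<phi> (inv (g i) \<otimes> g j)))"
    by (simp add: complex_nonneg_Reals_iff)
  moreover have "(\<Sum>i<n. \<Sum>j<n. c i * c j * (1 - Re (\<phi> (inv (g i) \<otimes> g j)))) =
      (\<Sum>i<n. c i) * (\<Sum>j<n. c j) - (\<Sum>i<n. \<Sum>j<n. c i * c j * Re (\<phi> (inv (g i) \<otimes> g j)))"
    by (simp add: right_diff_distrib sum_subtractf sum_product)
  ultimately show "(\<Sum>i<n. \<Sum>j<n. c i * c j * (1 - Re (\<phi> (inv (g i) \<otimes> g j)))) \<le> 0"
    using c by simp
qed

end

subsection \<open>The family defining the \<open>H\<close>-metric\<close>

text \<open>The index set of the supremum in \<open>H_Psi\<close>, written literally as there so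
  that it can be folded into that definition.\<close>

definition H_family :: "('a, 'm) monoid_scheme \<Rightarrow> 'a topology \<Rightarrow> 'a set \<Rightarrow> ('a \<Rightarrow> real) set" where
  "H_family G T K = {\<psi>. continuous_map T euclideanreal \<psi> \<and> cond_negative_definite G \<psi> \<and>
                  (\<forall>x\<in>K. \<psi> x \<le> 1)}"

lemma H_familyD:
  assumes "\<psi> \<in> H_family G T K"
  shows "continuous_map T euclideanreal \<psi>" "cond_negative_definite G \<psi>" "x \<in> K \<Longrightarrow> \<psi> x \<le> 1"
  using assms unfolding H_family_def by blast+

lemma zero_in_H_family: "(\<lambda>_. 0) \<in> H_family G T K"
  by (simp add: H_family_def cond_negative_definite_def)

lemma H_family_scale:
  assumes "continuous_map T euclideanreal \<psi>" "cond_negative_definite G \<psi>" "0 < \<delta>"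
    "\<And>x. x \<in> K \<Longrightarrow> \<psi> x \<le> \<delta>"
  shows "(\<lambda>g. 1 / \<delta> * \<psi> g) \<in> H_family G T K"
  unfolding H_family_def mem_Collect_eq
proof (intro conjI ballI)
  show "continuous_map T euclideanreal (\<lambda>g. 1 / \<delta> * \<psi> g)"
    by (intro continuous_map_real_mult assms(1)) simp
  show "cond_negative_definite G (\<lambda>g. 1 / \<delta> * \<psi> g)"
    using assms(3) by (intro cond_negative_definite_scale assms(2)) simp
  show "1 / \<delta> * \<psi> x \<le> 1" if "x \<in> K" for x
    using assms(3) assms(4)[OF that] by simp
qed

context group
begin

text \<open>This is the finiteness of \<open>H_Psi\<close>. The bound is uniform over the family and
  is built along a word in \<open>K\<close>: 1 on generators and their inverses, and the
  parallelogram-type bound at products.\<close>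

lemma H_family_bounded_at:
  assumes "K \<subseteq> carrier G" "g \<in> generate G K"
  shows "\<exists>B. \<forall>\<psi>\<in>H_family G T K. \<psi> g \<le> B"
  using assms(2)
proof induction
  case one
  have "\<psi> \<one> \<le> 0" if "\<psi> \<in> H_family G T K" for \<psi>
    using cond_negative_definite_one[OF H_familyD(2)[OF that]] by simp
  then show ?case by blast
next
  case (incl h)
  then show ?case by (intro exI[of _ 1] ballI) (rule H_familyD(3))
next
  case (inv h)
  have "\<psi> (inv h) \<le> 1" if "\<psi> \<in> H_family G T K" for \<psi>
  proof -
    have "\<psi> (inv h) = \<psi> h"
      using inv assms(1) by (intro cond_negative_definite_inv H_familyD(2)[OF that]) blast
    then show ?thesis using H_familyD(3)[OF that inv] by simp
  qed
  then show ?case by blast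
next
  case (eng h1 h2)
  then obtain B1 B2 where B: "\<forall>\<psi>\<in>H_family G T K. \<psi> h1 \<le> B1" "\<forall>\<psi>\<in>H_family G T K. \<psi> h2 \<le> B2"
    by blast
  have h: "h1 \<in> carrier G" "h2 \<in> carrier G"
    using eng.hyps generate_in_carrier[OF assms(1)] by auto
  have "\<psi> (h1 \<otimes> h2) \<le> 2 * (B1 + B2)" if "\<psi> \<in> H_family G T K" for \<psi>
    using cond_negative_definite_mult_le[OF H_familyD(2)[OF that] h] B that by fastforce
  then show ?case by blast
qed

end

section \<open>Uniform bounds near points and on compact sets\<close>

lemma openin_left_translate:
  assumes "locally_compact_group G T" "openin T U" "g \<in> carrier G"
  shows "openin T {x \<in> carrier G. g \<otimes>\<^bsub>G\<^esub> x \<in> U}"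
proof -
  from assms(1) have top: "topspace T = carrier G"
    and mult: "continuous_map (prod_topology T T) T (\<lambda>(x, y). x \<otimes>\<^bsub>G\<^esub> y)"
    by (auto simp: locally_compact_group_def)
  have "continuous_map T (prod_topology T T) (\<lambda>x. (g, x))"
    using assms(3) by (simp add: continuous_map_pairwise o_def top)
  then have "continuous_map T T ((\<lambda>(x, y). x \<otimes>\<^bsub>G\<^esub> y) \<circ> (\<lambda>x. (g, x)))"
    using mult by (rule continuous_map_compose)
  then show ?thesis
    using openin_continuous_map_preimage[OF _ assms(2)] by (fastforce simp: o_def top)
qed

text \<open>A left translate of the open set \<open>K\<close> is a neighbourhood of
  \<open>g\<close>; on it each \<psi> is controlled by its bound 1 on \<open>K\<close> and its value
  at the single translating element.\<close>

lemma H_family_locally_bounded: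
  fixes G (structure)
  assumes lcg: "locally_compact_group G T" and K: "H_generating_set G T K" and g: "g \<in> carrier G"
  shows "\<exists>U B. openin T U \<and> g \<in> U \<and> (\<forall>\<psi>\<in>H_family G T K. \<forall>x\<in>U. \<psi> x \<le> B)"
proof -
  from lcg have "group G" and top: "topspace T = carrier G"
    by (auto simp: locally_compact_group_def)
  then interpret group G by simp
  from K have op: "openin T K" and gen: "generate G K = carrier G"
    by (auto simp: H_generating_set_def)
  have KG: "K \<subseteq> carrier G" using openin_subset[OF op] top by simp
  note bounded = H_family_bounded_at[OF KG, unfolded gen]
  show ?thesis
  proof (cases "K = {}")
    \<comment> \<open>An empty \<open>K\<close> can generate only the trivial group, where the whole
      carrier serves as neighbourhood.\<close>
    case True
    then have "carrier G = {\<one>}" using gen generate_empty by simp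
    moreover have "openin T (carrier G)" using top by (metis openin_topspace)
    ultimately show ?thesis
      using bounded[OF g, of T] g by (intro exI[of _ "carrier G"]) auto
  next
    case False
    then obtain k where k: "k \<in> K" by blast
    then have kG: "k \<in> carrier G" using KG by blast
    \<comment> \<open>Chosen so that \<open>h \<otimes> g = k\<close> lies in
      \<open>K\<close>.\<close>
    define h where "h = k \<otimes> inv g"
    have h: "h \<in> carrier G" using kG g by (simp add: h_def)
    obtain B where B: "\<forall>\<psi>\<in>H_family G T K. \<psi> (inv h) \<le> B" using bounded[of "inv h" T] h by auto
    let ?U = "{x \<in> carrier G. h \<otimes> x \<in> K}"
    have "g \<in> ?U" using k kG g by (simp add: h_def m_assoc)
    moreover have "\<psi> x \<le> 2 * (B + 1)" if \<psi>: "\<psi> \<in> H_family G T K" and x: "x \<in> ?U" for \<psi> x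
    proof -
      have "x = inv h \<otimes> (h \<otimes> x)" using x h by (simp add: m_assoc[symmetric])
      then have "\<psi> x \<le> 2 * (\<psi> (inv h) + \<psi> (h \<otimes> x))"
        using cond_negative_definite_mult_le[OF H_familyD(2)[OF \<psi>], of "inv h" "h \<otimes> x"] x h by simp
      also have "\<dots> \<le> 2 * (B + 1)"
        using B \<psi> H_familyD(3)[OF \<psi>, of "h \<otimes> x"] x by fastforce
      finally show ?thesis .
    qed
    ultimately show ?thesis
      using openin_left_translate[OF lcg op h] by blast
  qed
qed

lemma H_family_bounded_on_compact:
  assumes "locally_compact_group G T" "H_generating_set G T K" "compactin T C"
  shows "\<exists>B. \<forall>\<psi>\<in>H_family G T K. \<forall>x\<in>C. \<psi> x \<le> B"
proof -
  have "C \<subseteq> carrier G"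
    using assms(1) compactin_subset_topspace[OF assms(3)] by (simp add: locally_compact_group_def)
  then have "\<forall>g\<in>C. \<exists>U B. openin T U \<and> g \<in> U \<and> (\<forall>\<psi>\<in>H_family G T K. \<forall>x\<in>U. \<psi> x \<le> B)"
    using H_family_locally_bounded[OF assms(1,2)] by blast
  then obtain U B where UB: "\<And>g. g \<in> C \<Longrightarrow> openin T (U g) \<and> g \<in> U g \<and> (\<forall>\<psi>\<in>H_family G T K. \<forall>x\<in>U g. \<psi> x \<le> B g)"
    by metis
  have "\<exists>\<F>. finite \<F> \<and> \<F> \<subseteq> U ` C \<and> C \<subseteq> \<Union>\<F>"
    using UB by (intro compactinD[OF assms(3)]) auto
  then obtain D where D: "finite D" "D \<subseteq> C" "C \<subseteq> \<Union>(U ` D)"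
    by (metis finite_subset_image)
  \<comment> \<open>The sum of absolute values stands in for a maximum and also covers empty
    \<open>D\<close>.\<close>
  have "\<psi> x \<le> (\<Sum>g\<in>D. \<bar>B g\<bar>)" if \<psi>: "\<psi> \<in> H_family G T K" and x: "x \<in> C" for \<psi> x
  proof -
    obtain g where g: "g \<in> D" "x \<in> U g" using D(3) x by blast
    then have "\<psi> x \<le> \<bar>B g\<bar>" using UB[of g] D(2) \<psi> by fastforce
    also have "\<dots> \<le> (\<Sum>g\<in>D. \<bar>B g\<bar>)" using D(1) g(1) by (intro member_le_sum) auto
    finally show ?thesis .
  qed
  then show ?thesis by blast
qed

section \<open>From the family to the supremum and the metric\<close>

lemma H_Psi_ge:
  assumes "locally_compact_group G T" "H_generating_set G T K" "g \<in> carrier G" "\<psi> \<in> H_family G T K"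
  shows "\<psi> g \<le> H_Psi G T K g"
proof -
  \<comment> \<open>Boundedness above comes first: it makes the real \<open>SUP\<close> an upper
    bound.\<close>
  obtain B where "\<forall>\<psi>\<in>H_family G T K. \<psi> g \<le> B"
    using H_family_locally_bounded[OF assms(1-3)] by blast
  then have "bdd_above ((\<lambda>\<psi>. \<psi> g) ` H_family G T K)"
    by (intro bdd_aboveI2[where M = B]) simp
  then show ?thesis
    unfolding H_Psi_def H_family_def[symmetric] by (intro cSUP_upper assms(4))
qed

lemma H_Psi_le:
  assumes "\<And>\<psi>. \<psi> \<in> H_family G T K \<Longrightarrow> \<psi> g \<le> B"
  shows "H_Psi G T K g \<le> B"
proof -
  have "H_family G T K \<noteq> {}"
    using zero_in_H_family[of G T K] by blast
  then show ?thesis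
    unfolding H_Psi_def H_family_def[symmetric] by (rule cSUP_least) (rule assms)
qed

text \<open>Pairwise distances are traded for a uniform bound on \<psi> over \<open>X\<close>. One
  direction writes \<open>x\<close> as \<open>x0 \<otimes> (inv x0 \<otimes> x)\<close> for a fixed
  \<open>x0\<close> in \<open>X\<close>, the other bounds \<psi> at
  \<open>inv x \<otimes> y\<close>.\<close>

lemma H_bounded_iff:
  fixes G (structure)
  assumes lcg: "locally_compact_group G T" and K: "H_generating_set G T K" and X: "X \<subseteq> carrier G"
  shows "H_bounded G T K X \<longleftrightarrow> (\<exists>B. \<forall>\<psi>\<in>H_family G T K. \<forall>x\<in>X. \<psi> x \<le> B)"
proof
  from lcg interpret group G by (simp add: locally_compact_group_def)
  show "\<exists>B. \<forall>\<psi>\<in>H_family G T K. \<forall>x\<in>X. \<psi> x \<le> B" if bd: "H_bounded G T K X"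
  proof (cases "X = {}")
    case False
    then obtain x0 where x0: "x0 \<in> X" by blast
    then have x0G: "x0 \<in> carrier G" using X by blast
    obtain B where B: "\<And>x y. x \<in> X \<Longrightarrow> y \<in> X \<Longrightarrow> sqrt (H_Psi G T K (inv x \<otimes> y)) \<le> B"
      using bd by (auto simp: H_bounded_def H_metric_def)
    obtain B0 where B0: "\<forall>\<psi>\<in>H_family G T K. \<psi> x0 \<le> B0"
      using H_family_locally_bounded[OF lcg K x0G] by blast
    have "\<psi> x \<le> 2 * (B0 + B\<^sup>2)" if \<psi>: "\<psi> \<in> H_family G T K" and x: "x \<in> X" for \<psi> x
    proof -
      have xG: "x \<in> carrier G" using x X by blast
      have "\<psi> (inv x0 \<otimes> x) \<le> H_Psi G T K (inv x0 \<otimes> x)"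
        using xG x0G by (intro H_Psi_ge[OF lcg K _ \<psi>]) simp
      also have "\<dots> \<le> B\<^sup>2" using B[OF x0 x] by (rule sqrt_le_D)
      finally have "\<psi> (inv x0 \<otimes> x) \<le> B\<^sup>2" .
      moreover have "\<psi> (x0 \<otimes> (inv x0 \<otimes> x)) \<le> 2 * (\<psi> x0 + \<psi> (inv x0 \<otimes> x))"
        using xG x0G by (intro cond_negative_definite_mult_le H_familyD(2)[OF \<psi>]) auto
      moreover have "x0 \<otimes> (inv x0 \<otimes> x) = x" using xG x0G by (simp add: m_assoc[symmetric])
      ultimately show ?thesis using B0 \<psi> by fastforce
    qed
    then show ?thesis by blast
  qed auto
  assume "\<exists>B. \<forall>\<psi>\<in>H_family G T K. \<forall>x\<in>X. \<psi> x \<le> B"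
  then obtain B where B: "\<And>\<psi> x. \<psi> \<in> H_family G T K \<Longrightarrow> x \<in> X \<Longrightarrow> \<psi> x \<le> B" by blast
  have "H_metric G T K x y \<le> sqrt (2 * (B + B))" if xy: "x \<in> X" "y \<in> X" for x y
    unfolding H_metric_def
  proof (intro real_sqrt_le_mono H_Psi_le)
    fix \<psi> assume \<psi>: "\<psi> \<in> H_family G T K"
    have xyG: "x \<in> carrier G" "y \<in> carrier G" using xy X by auto
    have "\<psi> (inv x \<otimes> y) \<le> 2 * (\<psi> (inv x) + \<psi> y)"
      using xyG by (intro cond_negative_definite_mult_le H_familyD(2)[OF \<psi>]) auto
    moreover have "\<psi> (inv x) = \<psi> x"
      using xyG by (intro cond_negative_definite_inv H_familyD(2)[OF \<psi>])
    ultimately show "\<psi> (inv x \<otimes> y) \<le> 2 * (B + B)"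
      using B[OF \<psi> xy(1)] B[OF \<psi> xy(2)] by simp
  qed
  then show "H_bounded G T K X" unfolding H_bounded_def by blast
qed

subsection \<open>Relative Property (T)\<close>

lemma H_family_bounded_imp_relative_property_T:
  fixes G (structure)
  assumes lcg: "locally_compact_group G T" and K: "H_generating_set G T K" and X: "X \<subseteq> carrier G"
    and B: "\<And>\<psi> x. \<psi> \<in> H_family G T K \<Longrightarrow> x \<in> X \<Longrightarrow> \<psi> x \<le> B"
  shows "relative_property_T G T X"
  unfolding relative_property_T_def
proof (intro allI impI)
  fix F :: "('a \<Rightarrow> complex) filter"
  assume ev: "\<forall>\<^sub>F \<phi> in F. \<phi> \<in> cont_normalized_pos_def G T"
    and lim: "\<forall>C. compactin T C \<longrightarrow> uniform_limit C (\<lambda>\<phi>. \<phi>) (\<lambda>_. 1) F"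
  from lcg interpret group G by (simp add: locally_compact_group_def)
  \<comment> \<open>Convergence is given on compact sets, hence it is applied to the closure of
    \<open>K\<close>.\<close>
  define C where "C = Abstract_Topology.closure_of T K"
  from K have "openin T K" "compactin T C"
    by (auto simp: H_generating_set_def C_def)
  then have sub: "K \<subseteq> C" and limK: "uniform_limit C (\<lambda>\<phi>. \<phi>) (\<lambda>_. 1) F"
    using lim by (simp_all add: C_def closure_of_subset openin_subset)
  show "uniform_limit X (\<lambda>\<phi>. \<phi>) (\<lambda>_. 1) F"
    unfolding uniform_limit_iff
  proof (intro allI impI)
    fix e :: real assume e: "0 < e"
    \<comment> \<open>Makes \<open>2 * \<bar>B\<bar> * \<delta>\<close> smaller than the square of
      \<open>e\<close>; the absolute value and the summand 1 keep the denominator positive for every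
      real \<open>B\<close>.\<close>
    define \<delta> where "\<delta> = e\<^sup>2 / (4 * (\<bar>B\<bar> + 1))"
    have \<delta>: "0 < \<delta>" using e by (simp add: \<delta>_def)
    have "2 * (\<bar>B\<bar> * \<delta>) < e\<^sup>2"
    proof -
      have "2 * (\<bar>B\<bar> * \<delta>) = e\<^sup>2 * (2 * \<bar>B\<bar> / (4 * (\<bar>B\<bar> + 1)))" by (simp add: \<delta>_def)
      also have "\<dots> < e\<^sup>2 * 1" using e by (intro mult_strict_left_mono) auto
      finally show ?thesis by simp
    qed
    note B\<delta> = this
    from limK \<delta> have "\<forall>\<^sub>F \<phi> in F. \<forall>x\<in>C. dist (\<phi> x) 1 < \<delta>"
      by (simp add: uniform_limit_iff)
    with ev show "\<forall>\<^sub>F \<phi> in F. \<forall>x\<in>X. dist (\<phi> x) 1 < e"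
    proof eventually_elim
      case (elim \<phi>)
      then have cont: "continuous_map T euclidean \<phi>" and pd: "positive_definite G \<phi>" "\<phi> \<one> = 1"
        by (auto simp: cont_normalized_pos_def_def)
      have "continuous_map T euclideanreal (Re \<circ> \<phi>)"
        by (rule continuous_map_compose[OF cont]) (simp add: continuous_on_Re)
      then have cont': "continuous_map T euclideanreal (\<lambda>g. 1 - Re (\<phi> g))"
        by (intro continuous_map_diff) (auto simp: o_def)
      have small: "1 - Re (\<phi> x) \<le> \<delta>" if "x \<in> K" for x
      proof -
        have "1 - Re (\<phi> x) \<le> dist (\<phi> x) 1"
          using abs_Re_le_cmod[of "\<phi> x - 1"] by (simp add: dist_norm)
        then show ?thesis using elim(2) sub that by fastforce
      qed
      have fam: "(\<lambda>g. 1 / \<delta> * (1 - Re (\<phi> g))) \<in> H_family G T K"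
        by (intro H_family_scale cont' positive_definite_imp_cond_negative_definite pd \<delta> small)
      show ?case
      proof
        fix x assume x: "x \<in> X"
        have "1 - Re (\<phi> x) \<le> B * \<delta>" using B[OF fam x] \<delta> by (simp add: field_simps)
        also have "\<dots> \<le> \<bar>B\<bar> * \<delta>" using \<delta> by (intro mult_right_mono) auto
        finally have "(dist (\<phi> x) 1)\<^sup>2 < e\<^sup>2"
          using positive_definite_dist_1_le[OF pd, of x] x X B\<delta> by fastforce
        then show "dist (\<phi> x) 1 < e" using e by (simp add: power_less_imp_less_base)
      qed
    qed
  qed
qed

lemma relative_property_T_imp_H_family_bounded:
  fixes G (structure)
  assumes lcg: "locally_compact_group G T" and K: "H_generating_set G T K" and X: "X \<subseteq> carrier G"
    and rel: "relative_property_T G T X"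
  shows "\<exists>B. \<forall>\<psi>\<in>H_family G T K. \<forall>x\<in>X. \<psi> x \<le> B"
proof (rule ccontr)
  from lcg have "group G" and top: "topspace T = carrier G"
    by (auto simp: locally_compact_group_def)
  then interpret group G by simp
  assume "\<nexists>B. \<forall>\<psi>\<in>H_family G T K. \<forall>x\<in>X. \<psi> x \<le> B"
  \<comment> \<open>The threshold matches the later scaling by \<open>1 / (real n + 1)\<close>: the
    scaled function exceeds 1 at \<open>x n\<close>.\<close>
  then have "\<forall>n::nat. \<exists>\<psi> x. \<psi> \<in> H_family G T K \<and> x \<in> X \<and> real n + 1 < \<psi> x"
    by (meson not_le)
  then obtain \<psi> x where \<psi>: "\<And>n. \<psi> n \<in> H_family G T K" and x: "\<And>n. x n \<in> X"
    and big: "\<And>n. real n + 1 < \<psi> n (x n)"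
    by metis
  define \<phi> where "\<phi> n g = complex_of_real (exp (- (1 / (real n + 1) * \<psi> n g)))" for n g
  have mem: "\<phi> n \<in> cont_normalized_pos_def G T" for n
  proof -
    have "continuous_map T euclideanreal (\<lambda>g. 1 / (real n + 1) * \<psi> n g)"
      by (intro continuous_map_real_mult H_familyD(1)[OF \<psi>]) auto
    then have "continuous_map T euclidean ((\<lambda>t. complex_of_real (exp (- t))) \<circ> (\<lambda>g. 1 / (real n + 1) * \<psi> n g))"
      by (rule continuous_map_compose) (auto intro!: continuous_intros)
    moreover have "positive_definite G (\<phi> n)"
      unfolding \<phi>_def[abs_def] by (intro schoenberg cond_negative_definite_scale H_familyD(2)[OF \<psi>]) simp
    moreover have "\<phi> n \<one> = 1"
      using cond_negative_definite_one[OF H_familyD(2)[OF \<psi>[of n]]] by (simp add: \<phi>_def)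
    ultimately show ?thesis
      by (simp add: cont_normalized_pos_def_def \<phi>_def[abs_def] o_def)
  qed
  have dist_\<phi>: "dist (\<phi> n g) 1 = \<bar>exp (- (\<psi> n g / (real n + 1))) - 1\<bar>" for n g
    using norm_of_real[of "exp (- (\<psi> n g / (real n + 1))) - 1", where 'a = complex]
    by (simp add: \<phi>_def dist_norm)
  \<comment> \<open>A sequence suffices as counterexample; its filter of tails is the image of
    \<open>sequentially\<close>.\<close>
  define F where "F = filtermap \<phi> sequentially"
  have unif: "uniform_limit S (\<lambda>\<phi>. \<phi>) (\<lambda>_. 1) F \<longleftrightarrow>
      (\<forall>e>0. \<forall>\<^sub>F n in sequentially. \<forall>x\<in>S. dist (\<phi> n x) 1 < e)" for S
    by (simp add: uniform_limit_iff F_def eventually_filtermap)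
  have "uniform_limit C (\<lambda>\<phi>. \<phi>) (\<lambda>_. 1) F" if C: "compactin T C" for C
    unfolding unif
  proof (intro allI impI)
    fix e :: real assume "0 < e"
    obtain B where B: "\<And>\<psi> x. \<psi> \<in> H_family G T K \<Longrightarrow> x \<in> C \<Longrightarrow> \<psi> x \<le> B"
      using H_family_bounded_on_compact[OF lcg K C] by blast
    have "(\<lambda>n. B / (real n + 1)) \<longlonglongrightarrow> 0"
      using LIMSEQ_Suc[OF lim_const_over_n[of B]] by (simp add: add.commute)
    then have "\<forall>\<^sub>F n in sequentially. B / (real n + 1) < e"
      using \<open>0 < e\<close> by (rule order_tendstoD(2))
    then show "\<forall>\<^sub>F n in sequentially. \<forall>x\<in>C. dist (\<phi> n x) 1 < e"
    proof eventually_elim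
      case (elim n)
      show ?case
      proof
        fix x assume x: "x \<in> C"
        then have "x \<in> carrier G" using compactin_subset_topspace[OF C] top by blast
        define t where "t = \<psi> n x / (real n + 1)"
        have "0 \<le> t"
          using cond_negative_definite_nonneg[OF H_familyD(2)[OF \<psi>] \<open>x \<in> carrier G\<close>] by (simp add: t_def)
        moreover have "t < e"
          using elim divide_right_mono[OF B[OF \<psi> x, of n], of "real n + 1"] by (simp add: t_def)
        \<comment> \<open>Together with the next line this places \<open>1 - exp (- t)\<close>
          between 0 and \<open>t\<close>.\<close>
        moreover have "1 - t \<le> exp (- t)" using exp_ge_add_one_self[of "- t"] by simp
        moreover have "exp (- t) \<le> 1" using \<open>0 \<le> t\<close> by simp
        ultimately show "dist (\<phi> n x) 1 < e"
          by (simp add: dist_\<phi> t_def[symmetric])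
      qed
    qed
  qed
  moreover have "\<forall>\<^sub>F \<phi> in F. \<phi> \<in> cont_normalized_pos_def G T"
    by (simp add: F_def eventually_filtermap mem)
  ultimately have "uniform_limit X (\<lambda>\<phi>. \<phi>) (\<lambda>_. 1) F"
    using rel unfolding relative_property_T_def by blast
  then have "\<forall>\<^sub>F n in sequentially. \<forall>x\<in>X. dist (\<phi> n x) 1 < 1 / 2"
    unfolding unif by (rule allE[of _ "1 / 2"]) simp
  then obtain n where "\<forall>x\<in>X. dist (\<phi> n x) 1 < 1 / 2"
    using eventually_happens by fastforce
  then have "dist (\<phi> n (x n)) 1 < 1 / 2" using x by blast
  \<comment> \<open>So the distance from 1 at \<open>x n\<close> is at least 1/2 for every
    \<open>n\<close>, against uniform convergence on \<open>X\<close>.\<close>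
  moreover have "exp (- (\<psi> n (x n) / (real n + 1))) \<le> 1 / 2"
  proof -
    define t where "t = \<psi> n (x n) / (real n + 1)"
    have "1 \<le> t" using big[of n] by (simp add: t_def field_simps)
    then have "2 \<le> exp t" using exp_ge_add_one_self[of t] by linarith
    then have "exp (- t) \<le> 1 / 2" by (simp add: exp_minus field_simps)
    then show ?thesis by (simp only: t_def)
  qed
  ultimately show False unfolding dist_\<phi> by linarith
qed

theorem proposition2p6p1:
  fixes G :: "('a, 'm) monoid_scheme" and T :: "'a topology" and K X :: "'a set"
  assumes "locally_compact_group G T"
    and "compactly_generated_group G T"
    and "H_generating_set G T K"
    and "X \<subseteq> carrier G"
  shows "relative_property_T G T X \<longleftrightarrow> H_bounded G T K X"
  unfolding H_bounded_iff[OF assms(1,3,4)]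
proof
  assume "relative_property_T G T X"
  then show "\<exists>B. \<forall>\<psi>\<in>H_family G T K. \<forall>x\<in>X. \<psi> x \<le> B"
    by (rule relative_property_T_imp_H_family_bounded[OF assms(1,3,4)])
next
  assume "\<exists>B. \<forall>\<psi>\<in>H_family G T K. \<forall>x\<in>X. \<psi> x \<le> B"
  then obtain B where "\<forall>\<psi>\<in>H_family G T K. \<forall>x\<in>X. \<psi> x \<le> B" ..
  then show "relative_property_T G T X"
    by (intro H_family_bounded_imp_relative_property_T[OF assms(1,3,4), of B]) simp
qed

end
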